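(* Define the matrix $\widetilde{\mathbb{L}} = \widetilde{\mathbf L}^* \mathbf E\, \widetilde{\mathbf U} \in \mathbb{C}^{N_q\times N_p}$. Then, for $1\le k\le N_q$ and $1\le j\le N_p$, the $(k,j)$ entry of $\widetilde{\mathbb{L}}$ is $$ \widetilde{\mathbb{L}}_{k,j} = \begin{cases} -\phi_k\rho_j \dfrac{H(\mathrm{i}\omega_k)-H(\mathrm{i}\zeta_j)}{\mathrm{i}\omega_k-\mathrm{i}\zeta_j}, & 1\le k\le \ell_q,\ 1\le j\le \ell_p,\\[2mm] \phi_k\rho_\infty H(\mathrm{i}\omega_k), & 1\le k\le \ell_q,\ j=N_p=\ell_p+1,\\[1mm] \phi_\infty\rho_j H(\mathrm{i}\zeta_j), & k=N_q=\ell_q+1,\ 1\le j\le \ell_p,\\[1mm] \phi_\infty\rho_\infty M_0, & k=N_q=\ell_q+1,\ j=N_p=\ell_p+1. \end{cases} $$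
   Context: Let $\mathbf E,\mathbf A\in\mathbb{R}^{n\times n}$ and $\mathbf b,\mathbf c\in\mathbb{R}^n$, with $\mathbf E$ nonsingular and the pencil $(\mathbf A,\mathbf E)$ asymptotically stable, i.e. all eigenvalues of $\mathbf E^{-1}\mathbf A$ lie in the open left half-plane. The transfer function is $H(s)=\mathbf c^T(s\mathbf E-\mathbf A)^{-1}\mathbf b$, and the zeroth Markov parameter is $M_0=\mathbf c^T\mathbf E^{-1}\mathbf b$. Here $\mathrm{i}^2=-1$. Let $\zeta_1,\dots,\zeta_{\ell_p}\in\mathbb{R}$ and $\omega_1,\dots,\omega_{\ell_q}\in\mathbb{R}$ be quadrature nodes, with $\omega_k\neq\zeta_j$ for all $k,j$, and let $\rho_j^2$, $\phi_k^2$ be the corresponding quadrature weights ($\rho_j,\phi_k$ real). Each of the two quadrature rules may in addition contain a "node at infinity" with weight $\rho_\infty^2$ (resp. $\phi_\infty^2$), where $\rho_\infty,\phi_\infty$ are real. The total number of nodes is $N_p=\ell_p$ if the node at infinity is absent from the first rule and $N_p=\ell_p+1$ if it is present; likewise $N_q=\ell_q$ or $N_q=\ell_q+1$ for the second rule. Define $$\widetilde{\mathbf U}=\big[\rho_1(\mathrm{i}\zeta_1\mathbf E-\mathbf A)^{-1}\mathbf b\ \ \cdots\ \ \rho_{\ell_p}(\mathrm{i}\zeta_{\ell_p}\mathbf E-\mathbf A)^{-1}\mathbf b\ \ \ \rho_\infty\mathbf E^{-1}\mathbf b\big]\in\mathbb{C}^{n\times N_p},$$ $$\widetilde{\mathbf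 L}^*=\begin{bmatrix}\phi_1\mathbf c^T(\mathrm{i}\omega_1\mathbf E-\mathbf A)^{-1}\\ \vdots\\ \phi_{\ell_q}\mathbf c^T(\mathrm{i}\omega_{\ell_q}\mathbf E-\mathbf A)^{-1}\\ \phi_\infty\mathbf c^T\mathbf E^{-1}\end{bmatrix}\in\mathbb{C}^{N_q\times n},$$ where the last column of $\widetilde{\mathbf U}$ (resp. last row of $\widetilde{\mathbf L}^*$) is omitted if the corresponding node at infinity is absent. Cases in the claim referring to an index $j=\ell_p+1$ or $k=\ell_q+1$ apply only when the corresponding node at infinity is present. ${}^*$ denotes conjugate transpose. *)

theory Defs
  imports
    "HOL.Complex"
    "Jordan_Normal_Form.Char_Poly"
    "Jordan_Normal_Form.Gauss_Jordan_Elimination"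
begin

abbreviation cmat :: "real mat \<Rightarrow> complex mat" where
  "cmat \<equiv> map_mat complex_of_real"

abbreviation cvec :: "real vec \<Rightarrow> complex vec" where
  "cvec \<equiv> map_vec complex_of_real"

text \<open>On singular matrices \<open>mat_inv\<close> has an unspecified value; on invertible ones
  it is the inverse (see \<open>mat_inv\<close> below).\<close>

definition mat_inv :: "'a::field mat \<Rightarrow> 'a mat" where
  "mat_inv M = the (mat_inverse M)"

lemma mat_inv:
  fixes M :: "'a::field mat"
  assumes M: "M \<in> carrier_mat n n" and inv: "invertible_mat M"
  shows "mat_inv M \<in> carrier_mat n n" "M * mat_inv M = 1\<^sub>m n" "mat_inv M * M = 1\<^sub>m n"
proof -
  from inv obtain B where MB: "M * B = 1\<^sub>m (dim_row M)" and BM: "B * M = 1\<^sub>m (dim_row B)"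
    unfolding invertible_mat_def inverts_mat_def by blast
  from arg_cong[OF MB, of dim_col] arg_cong[OF BM, of dim_col] M
  have B: "B \<in> carrier_mat n n" by auto
  with MB BM M have "M \<in> Units (ring_mat TYPE('a) n ())"
    unfolding Units_def ring_mat_def by auto
  with mat_inverse(1)[OF M] obtain C where "mat_inverse M = Some C" by fastforce
  with mat_inverse(2)[OF M this]
  show "mat_inv M \<in> carrier_mat n n" "M * mat_inv M = 1\<^sub>m n" "mat_inv M * M = 1\<^sub>m n"
    by (auto simp: mat_inv_def)
qed

definition asymptotically_stable :: "real mat \<Rightarrow> real mat \<Rightarrow> bool" where
  "asymptotically_stable A E \<longleftrightarrow>
     (\<forall>z. eigenvalue (cmat (mat_inv E * A)) z \<longrightarrow> Re z < 0)"

definition resolvent :: "real mat \<Rightarrow> real mat \<Rightarrow> complex \<Rightarrow> complex mat" where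
  "resolvent E A s = mat_inv (s \<cdot>\<^sub>m cmat E - cmat A)"

text \<open>The scalar product \<open>\<bullet>\<close> does not conjugate, so \<open>c \<bullet> v\<close> is \<open>c\<^sup>T v\<close>.\<close>

definition transfer :: "real mat \<Rightarrow> real mat \<Rightarrow> real vec \<Rightarrow> real vec \<Rightarrow> complex \<Rightarrow> complex" where
  "transfer E A b c s = cvec c \<bullet> (resolvent E A s *\<^sub>v cvec b)"

definition markov0 :: "real mat \<Rightarrow> real vec \<Rightarrow> real vec \<Rightarrow> real" where
  "markov0 E b c = c \<bullet> (mat_inv E *\<^sub>v b)"

definition num_nodes :: "nat \<Rightarrow> bool \<Rightarrow> nat" where
  "num_nodes l has_inf = (if has_inf then l + 1 else l)"

text \<open>A quadrature rule with \<open>l\<close> finite nodes is given by the nodes \<open>\<zeta> 0, \<dots>, \<zeta> (l - 1)\<close>, reals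
  \<open>\<rho> 0, \<dots>, \<rho> (l - 1)\<close> of any sign whose squares are their weights, a flag \<open>has_inf\<close> telling whether the node at
  infinity is present, and a real \<open>\<rho>inf\<close> whose square is its weight (irrelevant if it is absent).
  Indices start at 0, so index \<open>l\<close> is the node at infinity.\<close>

definition Util :: "real mat \<Rightarrow> real mat \<Rightarrow> real vec \<Rightarrow>
    nat \<Rightarrow> (nat \<Rightarrow> real) \<Rightarrow> (nat \<Rightarrow> real) \<Rightarrow> bool \<Rightarrow> real \<Rightarrow> complex mat" where
  "Util E A b l \<zeta> \<rho> has_inf \<rho>inf = mat_of_cols (dim_row E)
     (map (\<lambda>j. of_real (\<rho> j) \<cdot>\<^sub>v (resolvent E A (\<i> * of_real (\<zeta> j)) *\<^sub>v cvec b)) [0..<l]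
      @ (if has_inf then [of_real \<rho>inf \<cdot>\<^sub>v cvec (mat_inv E *\<^sub>v b)] else []))"

text \<open>This is the conjugate transpose \<open>L\<^sup>*\<close> itself, given by its rows, not \<open>L\<close>. A row vector
  \<open>c\<^sup>T M\<close> is written as \<open>M\<^sup>T c\<close>.\<close>

definition Ltil_star :: "real mat \<Rightarrow> real mat \<Rightarrow> real vec \<Rightarrow>
    nat \<Rightarrow> (nat \<Rightarrow> real) \<Rightarrow> (nat \<Rightarrow> real) \<Rightarrow> bool \<Rightarrow> real \<Rightarrow> complex mat" where
  "Ltil_star E A c l \<omega> \<phi> has_inf \<phi>inf = mat_of_rows (dim_row E)
     (map (\<lambda>k. of_real (\<phi> k) \<cdot>\<^sub>v ((resolvent E A (\<i> * of_real (\<omega> k)))\<^sup>T *\<^sub>v cvec c)) [0..<l]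
      @ (if has_inf then [of_real \<phi>inf \<cdot>\<^sub>v cvec ((mat_inv E)\<^sup>T *\<^sub>v c)] else []))"

end

theory Submission
  imports Defs
begin

text \<open>Write \<open>P s = s E - A\<close> for the pencil. By stability \<open>P s\<close> is invertible at every point \<open>s\<close> of
  the imaginary axis: a kernel vector of \<open>P s\<close> is an eigenvector of \<open>E\<^sup>-\<^sup>1 A\<close> with eigenvalue \<open>s\<close>,
  and such an eigenvalue has negative real part. So all resolvents in the two factors are true
  inverses (lemma \<open>invertible_pencil\<close>).

  Every column of \<open>U\<close> is a scalar times \<open>Y b\<close> and every row of \<open>L\<^sup>*\<close> is a scalar times
  \<open>c\<^sup>T X\<close>, where \<open>X\<close> and \<open>Y\<close> are resolvents or, at a node at infinity, \<open>E\<^sup>-\<^sup>1\<close>. Hence every entry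
  of \<open>L\<^sup>* E U\<close> is a scalar times \<open>c\<^sup>T (X E Y) b\<close> (lemma \<open>loewner_entry\<close>), and only the product
  \<open>X E Y\<close> has to be found. If one factor is \<open>E\<^sup>-\<^sup>1\<close>, it cancels against \<open>E\<close>. If both are resolvents,
  then \<open>P s - P t = (s - t) E\<close> gives the resolvent identity
  \<open>(s - t) (P s)\<^sup>-\<^sup>1 E (P t)\<^sup>-\<^sup>1 = (P t)\<^sup>-\<^sup>1 - (P s)\<^sup>-\<^sup>1\<close> (lemma \<open>resolvent_identity\<close>), which turns
  \<open>c\<^sup>T (X E Y) b\<close> into the negative divided difference of the transfer function.\<close>

section \<open>The pencil on the imaginary axis\<close>

lemma cmat_mat_inv:
  assumes E: "E \<in> carrier_mat n n" and inv: "invertible_mat E"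
  shows "cmat (mat_inv E) \<in> carrier_mat n n"
    and "cmat E * cmat (mat_inv E) = 1\<^sub>m n"
    and "cmat (mat_inv E) * cmat E = 1\<^sub>m n"
proof -
  note I = mat_inv[OF E inv]
  show "cmat (mat_inv E) \<in> carrier_mat n n" using I(1) by simp
  show "cmat E * cmat (mat_inv E) = 1\<^sub>m n"
    using of_real_hom.mat_hom_mult[OF E I(1), where 'a = complex] I(2)
    by (simp add: of_real_hom.mat_hom_one)
  show "cmat (mat_inv E) * cmat E = 1\<^sub>m n"
    using of_real_hom.mat_hom_mult[OF I(1) E, where 'a = complex] I(3)
    by (simp add: of_real_hom.mat_hom_one)
qed

lemma invertible_mat_if_det_nonzero:
  fixes M :: "'a::field mat"
  assumes M: "M \<in> carrier_mat n n" and det: "det M \<noteq> 0"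
  shows "invertible_mat M"
proof -
  from det_non_zero_imp_unit[OF M det, of "()"] obtain B where
    B: "B \<in> carrier_mat n n" "M * B = 1\<^sub>m n" "B * M = 1\<^sub>m n"
    unfolding Units_def ring_mat_def by auto
  then show ?thesis
    using M unfolding invertible_mat_def inverts_mat_def by auto
qed

lemma smult_mat_mult_vec:
  assumes "M \<in> carrier_mat m n" and "v \<in> carrier_vec n"
  shows "(k \<cdot>\<^sub>m M) *\<^sub>v v = (k :: 'a::comm_ring) \<cdot>\<^sub>v (M *\<^sub>v v)"
  using assms by (intro eq_vecI) (auto simp: scalar_prod_def sum_distrib_left ac_simps)

text \<open>If \<open>(s E - A) v = 0\<close> with \<open>v\<close> nonzero, then \<open>E\<^sup>-\<^sup>1 A v = s v\<close>, so \<open>s\<close> is an eigenvalue outside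
  the open left half-plane, against stability.\<close>

lemma invertible_pencil:
  assumes E: "E \<in> carrier_mat n n" and A: "A \<in> carrier_mat n n"
    and inv: "invertible_mat E" and stable: "asymptotically_stable A E"
    and s: "Re s \<ge> 0"
  shows "invertible_mat (s \<cdot>\<^sub>m cmat E - cmat A)"
proof (rule invertible_mat_if_det_nonzero)
  note I = mat_inv[OF E inv] and CI = cmat_mat_inv[OF E inv]
  have CE: "cmat E \<in> carrier_mat n n" and CA: "cmat A \<in> carrier_mat n n"
    using E A by auto
  show P: "s \<cdot>\<^sub>m cmat E - cmat A \<in> carrier_mat n n" using CA by auto
  show "det (s \<cdot>\<^sub>m cmat E - cmat A) \<noteq> 0"
  proof
    assume "det (s \<cdot>\<^sub>m cmat E - cmat A) = 0"
    then obtain v where v: "v \<in> carrier_vec n" "v \<noteq> 0\<^sub>v n"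
      and ker: "(s \<cdot>\<^sub>m cmat E - cmat A) *\<^sub>v v = 0\<^sub>v n"
      using det_0_iff_vec_prod_zero[OF P] by auto
    have diff: "s \<cdot>\<^sub>v (cmat E *\<^sub>v v) - cmat A *\<^sub>v v = 0\<^sub>v n"
      using ker minus_mult_distrib_mat_vec[of "s \<cdot>\<^sub>m cmat E" n n "cmat A" v] CE CA v(1)
      by (simp add: smult_mat_mult_vec[of _ n n])
    have Av: "cmat A *\<^sub>v v = s \<cdot>\<^sub>v (cmat E *\<^sub>v v)"
    proof (rule eq_vecI)
      fix i assume "i < dim_vec (s \<cdot>\<^sub>v (cmat E *\<^sub>v v))"
      then have i: "i < n" using E by simp
      from arg_cong[OF diff, of "\<lambda>u. u $ i"]
      show "(cmat A *\<^sub>v v) $ i = (s \<cdot>\<^sub>v (cmat E *\<^sub>v v)) $ i"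
        using i E A by simp
    qed (use E A in simp)
    have "cmat (mat_inv E * A) *\<^sub>v v = cmat (mat_inv E) *\<^sub>v (cmat A *\<^sub>v v)"
      using CI(1) CA v(1) by (simp add: of_real_hom.mat_hom_mult[OF I(1) A])
    also have "\<dots> = s \<cdot>\<^sub>v (cmat (mat_inv E) *\<^sub>v (cmat E *\<^sub>v v))"
      unfolding Av by (rule mult_mat_vec[OF CI(1)]) (use CE v in auto)
    also have "cmat (mat_inv E) *\<^sub>v (cmat E *\<^sub>v v) = v"
      using assoc_mult_mat_vec[OF CI(1) CE v(1)] CI(3) v(1) by simp
    finally have "eigenvector (cmat (mat_inv E * A)) v s"
      using v I(1) A by (simp add: eigenvector_def)
    then have "Re s < 0"
      using stable unfolding asymptotically_stable_def eigenvalue_def by blast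
    with s show False by simp
  qed
qed

section \<open>The resolvent identity\<close>

text \<open>Multiply \<open>P s - P t = (s - t) E\<close> by \<open>(P s)\<^sup>-\<^sup>1\<close> from the left and by \<open>(P t)\<^sup>-\<^sup>1\<close> from the
  right: in each term of the difference, one inverse cancels.\<close>

lemma resolvent_identity:
  assumes E: "E \<in> carrier_mat n n" and A: "A \<in> carrier_mat n n"
    and inv_s: "invertible_mat (s \<cdot>\<^sub>m cmat E - cmat A)"
    and inv_t: "invertible_mat (t \<cdot>\<^sub>m cmat E - cmat A)"
  shows "(s - t) \<cdot>\<^sub>m (resolvent E A s * cmat E * resolvent E A t)
       = resolvent E A t - resolvent E A s"
proof -
  define P where "P z = z \<cdot>\<^sub>m cmat E - cmat A" for z :: complex
  have CE: "cmat E \<in> carrier_mat n n" using E by simp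
  have P: "P z \<in> carrier_mat n n" for z using A by (auto simp: P_def)
  note Rs = mat_inv[OF P inv_s[folded P_def], folded resolvent_def[of E A s, folded P_def]]
  note Rt = mat_inv[OF P inv_t[folded P_def], folded resolvent_def[of E A t, folded P_def]]
  let ?R = "resolvent E A s" and ?T = "resolvent E A t"
  have pencil_diff: "(s - t) \<cdot>\<^sub>m cmat E = P s - P t"
    using E A by (intro eq_matI) (auto simp: P_def algebra_simps)
  have "(s - t) \<cdot>\<^sub>m (?R * cmat E * ?T) = ?R * ((s - t) \<cdot>\<^sub>m cmat E) * ?T"
    using Rs(1) Rt(1) CE
    by (simp add: mult_smult_distrib[of _ n n _ n] mult_smult_assoc_mat[of _ n n _ n])
  also have "\<dots> = ?R * P s * ?T - ?R * P t * ?T"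
    unfolding pencil_diff mult_minus_distrib_mat[OF Rs(1) P P]
    by (rule minus_mult_distrib_mat[of _ n n]) (use Rs(1) Rt(1) P in auto)
  also have "?R * P t * ?T = ?R"
    using assoc_mult_mat[OF Rs(1) P Rt(1)] Rt(2) Rs(1) by simp
  also have "?R * P s * ?T = ?T"
    using Rs(3) Rt(1) by simp
  finally show ?thesis .
qed

text \<open>Sandwiching the identity between \<open>c\<^sup>T\<close> and \<open>b\<close> gives the Loewner quotient.\<close>

lemma transfer_divided_difference:
  assumes E: "E \<in> carrier_mat n n" and A: "A \<in> carrier_mat n n"
    and b: "b \<in> carrier_vec n" and c: "c \<in> carrier_vec n"
    and inv_s: "invertible_mat (s \<cdot>\<^sub>m cmat E - cmat A)"
    and inv_t: "invertible_mat (t \<cdot>\<^sub>m cmat E - cmat A)"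
    and st: "s \<noteq> t"
  shows "cvec c \<bullet> (resolvent E A s * cmat E * resolvent E A t *\<^sub>v cvec b)
       = - ((transfer E A b c s - transfer E A b c t) / (s - t))"
proof -
  have P: "z \<cdot>\<^sub>m cmat E - cmat A \<in> carrier_mat n n" for z :: complex using A by auto
  note R = mat_inv(1)[OF P inv_s, folded resolvent_def]
    and T = mat_inv(1)[OF P inv_t, folded resolvent_def]
  let ?M = "resolvent E A s * cmat E * resolvent E A t"
  have M: "?M \<in> carrier_mat n n" using R T E by simp
  have bC: "cvec b \<in> carrier_vec n" and cC: "cvec c \<in> carrier_vec n" using b c by auto
  have "(s - t) * (cvec c \<bullet> (?M *\<^sub>v cvec b)) = cvec c \<bullet> (((s - t) \<cdot>\<^sub>m ?M) *\<^sub>v cvec b)"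
    unfolding smult_mat_mult_vec[OF M bC]
    by (rule scalar_prod_smult_distrib[symmetric]) (use cC M bC in auto)
  also have "\<dots> = transfer E A b c t - transfer E A b c s"
    unfolding resolvent_identity[OF E A inv_s inv_t] minus_mult_distrib_mat_vec[OF T R bC] transfer_def
    by (rule scalar_prod_minus_distrib) (use cC R T bC in auto)
  finally show ?thesis using st by (simp add: field_simps)
qed

section \<open>Entries of the Loewner matrix\<close>

text \<open>The matrix attached to node \<open>j\<close> of a rule with \<open>l\<close> finite nodes, and the real (of
  either sign) whose square is its weight. Treating the node at infinity as one more node makes all
  columns of \<open>U\<close>, and all rows of \<open>L\<^sup>*\<close>, instances of one formula.\<close>

definition node_mat :: "real mat \<Rightarrow> real mat \<Rightarrow> nat \<Rightarrow> (nat \<Rightarrow> real) \<Rightarrow> nat \<Rightarrow> complex mat" where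
  "node_mat E A l \<zeta> j =
     (if j < l then resolvent E A (\<i> * of_real (\<zeta> j)) else cmat (mat_inv E))"

definition node_root :: "nat \<Rightarrow> (nat \<Rightarrow> real) \<Rightarrow> real \<Rightarrow> nat \<Rightarrow> complex" where
  "node_root l \<rho> \<rho>inf j = of_real (if j < l then \<rho> j else \<rho>inf)"

lemma node_mat_carrier:
  assumes E: "E \<in> carrier_mat n n" and A: "A \<in> carrier_mat n n"
    and inv: "invertible_mat E" and stable: "asymptotically_stable A E"
  shows "node_mat E A l \<zeta> j \<in> carrier_mat n n"
proof (cases "j < l")
  case True
  have "(\<i> * of_real (\<zeta> j)) \<cdot>\<^sub>m cmat E - cmat A \<in> carrier_mat n n" using A by auto
  from mat_inv(1)[OF this invertible_pencil[OF E A inv stable]] True show ?thesis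
    by (simp add: node_mat_def resolvent_def)
next
  case False
  then show ?thesis using cmat_mat_inv(1)[OF E inv] by (simp add: node_mat_def)
qed

lemma Util_carrier:
  assumes "E \<in> carrier_mat n n"
  shows "Util E A b l \<zeta> \<rho> has_inf \<rho>inf \<in> carrier_mat n (num_nodes l has_inf)"
  by (rule carrier_matI) (use assms in \<open>simp_all add: Util_def num_nodes_def\<close>)

lemma Ltil_star_carrier:
  assumes "E \<in> carrier_mat n n"
  shows "Ltil_star E A c l \<omega> \<phi> has_inf \<phi>inf \<in> carrier_mat (num_nodes l has_inf) n"
  by (rule carrier_matI) (use assms in \<open>simp_all add: Ltil_star_def num_nodes_def\<close>)

lemma col_Util:
  assumes E: "E \<in> carrier_mat n n" and A: "A \<in> carrier_mat n n" and b: "b \<in> carrier_vec n"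
    and inv: "invertible_mat E" and stable: "asymptotically_stable A E"
    and j: "j < num_nodes l has_inf"
  shows "col (Util E A b l \<zeta> \<rho> has_inf \<rho>inf) j
       = node_root l \<rho> \<rho>inf j \<cdot>\<^sub>v (node_mat E A l \<zeta> j *\<^sub>v cvec b)"
proof -
  let ?cols = "map (\<lambda>j. of_real (\<rho> j) \<cdot>\<^sub>v (resolvent E A (\<i> * of_real (\<zeta> j)) *\<^sub>v cvec b)) [0..<l]
      @ (if has_inf then [of_real \<rho>inf \<cdot>\<^sub>v cvec (mat_inv E *\<^sub>v b)] else [])"
  have len: "j < length ?cols" using j by (auto simp: num_nodes_def)
  have nth: "?cols ! j = node_root l \<rho> \<rho>inf j \<cdot>\<^sub>v (node_mat E A l \<zeta> j *\<^sub>v cvec b)"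
  proof (cases "j < l")
    case True
    then show ?thesis by (simp add: nth_append node_root_def node_mat_def)
  next
    case False
    with j have "has_inf" "j = l" by (auto simp: num_nodes_def split: if_splits)
    then show ?thesis
      unfolding of_real_hom.mult_mat_vec_hom[OF mat_inv(1)[OF E inv] b]
      by (simp add: nth_append node_root_def node_mat_def)
  qed
  have "?cols ! j \<in> carrier_vec n"
    unfolding nth using node_mat_carrier[OF E A inv stable, of l \<zeta> j] b by auto
  then show ?thesis
    unfolding Util_def using col_mat_of_cols[OF len] nth E by simp
qed

lemma row_Ltil_star:
  assumes E: "E \<in> carrier_mat n n" and A: "A \<in> carrier_mat n n" and c: "c \<in> carrier_vec n"
    and inv: "invertible_mat E" and stable: "asymptotically_stable A E"
    and k: "k < num_nodes l has_inf"
  shows "row (Ltil_star E A c l \<omega> \<phi> has_inf \<phi>inf) k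
       = node_root l \<phi> \<phi>inf k \<cdot>\<^sub>v ((node_mat E A l \<omega> k)\<^sup>T *\<^sub>v cvec c)"
proof -
  let ?rows = "map (\<lambda>k. of_real (\<phi> k) \<cdot>\<^sub>v ((resolvent E A (\<i> * of_real (\<omega> k)))\<^sup>T *\<^sub>v cvec c)) [0..<l]
      @ (if has_inf then [of_real \<phi>inf \<cdot>\<^sub>v cvec ((mat_inv E)\<^sup>T *\<^sub>v c)] else [])"
  have len: "k < length ?rows" using k by (auto simp: num_nodes_def)
  have IT: "(mat_inv E)\<^sup>T \<in> carrier_mat n n" using mat_inv(1)[OF E inv] by simp
  have nth: "?rows ! k = node_root l \<phi> \<phi>inf k \<cdot>\<^sub>v ((node_mat E A l \<omega> k)\<^sup>T *\<^sub>v cvec c)"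
  proof (cases "k < l")
    case True
    then show ?thesis by (simp add: nth_append node_root_def node_mat_def)
  next
    case False
    with k have "has_inf" "k = l" by (auto simp: num_nodes_def split: if_splits)
    then show ?thesis
      unfolding of_real_hom.mult_mat_vec_hom[OF IT c]
      by (simp add: nth_append node_root_def node_mat_def map_mat_transpose)
  qed
  have "?rows ! k \<in> carrier_vec n"
    unfolding nth using node_mat_carrier[OF E A inv stable, of l \<omega> k] c by auto
  then show ?thesis
    unfolding Ltil_star_def using mat_of_rows_row[OF len] nth E by simp
qed

text \<open>Moving \<open>X\<^sup>T\<close> across the scalar product collects all matrices between \<open>c\<^sup>T\<close> and \<open>b\<close>.\<close>

lemma loewner_entry:
  assumes E: "E \<in> carrier_mat n n" and A: "A \<in> carrier_mat n n"
    and b: "b \<in> carrier_vec n" and c: "c \<in> carrier_vec n"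
    and inv: "invertible_mat E" and stable: "asymptotically_stable A E"
    and k: "k < num_nodes lq inf_q" and j: "j < num_nodes lp inf_p"
  shows "(Ltil_star E A c lq \<omega> \<phi> inf_q \<phi>inf * cmat E * Util E A b lp \<zeta> \<rho> inf_p \<rho>inf) $$ (k, j)
       = node_root lq \<phi> \<phi>inf k * node_root lp \<rho> \<rho>inf j
         * (cvec c \<bullet> (node_mat E A lq \<omega> k * cmat E * node_mat E A lp \<zeta> j *\<^sub>v cvec b))"
proof -
  let ?L = "Ltil_star E A c lq \<omega> \<phi> inf_q \<phi>inf" and ?U = "Util E A b lp \<zeta> \<rho> inf_p \<rho>inf"
  let ?X = "node_mat E A lq \<omega> k" and ?Y = "node_mat E A lp \<zeta> j"
  let ?x = "node_root lq \<phi> \<phi>inf k" and ?y = "node_root lp \<rho> \<rho>inf j"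
  note X = node_mat_carrier[OF E A inv stable, of lq \<omega> k]
    and Y = node_mat_carrier[OF E A inv stable, of lp \<zeta> j]
  note L = Ltil_star_carrier[OF E, of A c lq \<omega> \<phi> inf_q \<phi>inf]
    and U = Util_carrier[OF E, of A b lp \<zeta> \<rho> inf_p \<rho>inf]
  have CE: "cmat E \<in> carrier_mat n n" and bC: "cvec b \<in> carrier_vec n"
    and cC: "cvec c \<in> carrier_vec n" using E b c by auto
  have Yb: "?Y *\<^sub>v cvec b \<in> carrier_vec n" using Y bC by auto
  have EYb: "cmat E *\<^sub>v (?Y *\<^sub>v cvec b) \<in> carrier_vec n" using CE Yb by auto
  have XTc: "?X\<^sup>T *\<^sub>v cvec c \<in> carrier_vec n" using X cC by auto
  have "(?L * cmat E * ?U) $$ (k, j) = (?L * (cmat E * ?U)) $$ (k, j)"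
    using assoc_mult_mat[OF L CE U] by simp
  also have "\<dots> = row ?L k \<bullet> (cmat E *\<^sub>v col ?U j)"
    using L U CE j k by (simp add: col_mult2[OF CE U j])
  also have "\<dots> = (?x \<cdot>\<^sub>v (?X\<^sup>T *\<^sub>v cvec c)) \<bullet> (?y \<cdot>\<^sub>v (cmat E *\<^sub>v (?Y *\<^sub>v cvec b)))"
    unfolding row_Ltil_star[OF E A c inv stable k] col_Util[OF E A b inv stable j]
      mult_mat_vec[OF CE Yb] ..
  also have "\<dots> = ?x * ?y * ((?X\<^sup>T *\<^sub>v cvec c) \<bullet> (cmat E *\<^sub>v (?Y *\<^sub>v cvec b)))"
    using XTc EYb by simp
  also have "(?X\<^sup>T *\<^sub>v cvec c) \<bullet> (cmat E *\<^sub>v (?Y *\<^sub>v cvec b))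
      = cvec c \<bullet> (?X *\<^sub>v (cmat E *\<^sub>v (?Y *\<^sub>v cvec b)))"
    by (rule transpose_vec_mult_scalar[OF X EYb cC])
  also have "?X *\<^sub>v (cmat E *\<^sub>v (?Y *\<^sub>v cvec b)) = ?X * cmat E * ?Y *\<^sub>v cvec b"
    using assoc_mult_mat_vec[OF X CE Yb]
      assoc_mult_mat_vec[OF mult_carrier_mat[OF X CE] Y bC] by simp
  finally show ?thesis .
qed

lemma markov0_complex:
  assumes E: "E \<in> carrier_mat n n" and inv: "invertible_mat E"
    and b: "b \<in> carrier_vec n" and c: "c \<in> carrier_vec n"
  shows "cvec c \<bullet> (cmat (mat_inv E) *\<^sub>v cvec b) = of_real (markov0 E b c)"
proof -
  note I = mat_inv(1)[OF E inv]
  have "cvec c \<bullet> cvec (mat_inv E *\<^sub>v b) = of_real (c \<bullet> (mat_inv E *\<^sub>v b))"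
    using c I b by (simp add: scalar_prod_def)
  then show ?thesis
    by (simp add: markov0_def of_real_hom.mult_mat_vec_hom[OF I b])
qed

theorem proposition3p1:
  fixes n lp lq :: nat
    and E A :: "real mat" and b c :: "real vec"
    and \<zeta> \<rho> \<omega> \<phi> :: "nat \<Rightarrow> real"
    and inf_p inf_q :: bool and \<rho>inf \<phi>inf :: real
  assumes "E \<in> carrier_mat n n" "A \<in> carrier_mat n n"
    and "b \<in> carrier_vec n" "c \<in> carrier_vec n"
    and "invertible_mat E"
    and "asymptotically_stable A E"
    and "\<forall>k<lq. \<forall>j<lp. \<omega> k \<noteq> \<zeta> j"
  shows "let U = Util E A b lp \<zeta> \<rho> inf_p \<rho>inf;
             Lstar = Ltil_star E A c lq \<omega> \<phi> inf_q \<phi>inf;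
             LL = Lstar * cmat E * U;
             H = transfer E A b c;
             N\<^sub>p = num_nodes lp inf_p;
             N\<^sub>q = num_nodes lq inf_q
         in LL \<in> carrier_mat N\<^sub>q N\<^sub>p \<and>
            (\<forall>k<N\<^sub>q. \<forall>j<N\<^sub>p.
               LL $$ (k, j) =
                 (if k < lq \<and> j < lp then
                    - (of_real (\<phi> k) * of_real (\<rho> j)
                       * ((H (\<i> * of_real (\<omega> k)) - H (\<i> * of_real (\<zeta> j)))
                          / (\<i> * of_real (\<omega> k) - \<i> * of_real (\<zeta> j))))
                  else if k < lq then
                    of_real (\<phi> k) * of_real \<rho>inf * H (\<i> * of_real (\<omega> k))
                  else if j < lp then
                    of_real \<phi>inf * of_real (\<rho> j) * H (\<i> * of_real (\<zeta> j))
                  else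
                    of_real \<phi>inf * of_real \<rho>inf * of_real (markov0 E b c)))"
proof -
  note E = assms(1) and A = assms(2) and b = assms(3) and c = assms(4)
    and inv = assms(5) and stable = assms(6) and nodes = assms(7)
  note CI = cmat_mat_inv[OF E inv]
  have CE: "cmat E \<in> carrier_mat n n" using E by simp
  let ?LL = "Ltil_star E A c lq \<omega> \<phi> inf_q \<phi>inf * cmat E * Util E A b lp \<zeta> \<rho> inf_p \<rho>inf"
  let ?H = "transfer E A b c"
  have carrier: "?LL \<in> carrier_mat (num_nodes lq inf_q) (num_nodes lp inf_p)"
    by (rule mult_carrier_mat[OF mult_carrier_mat[OF Ltil_star_carrier[OF E] CE] Util_carrier[OF E]])
  have entry: "?LL $$ (k, j) =
      (if k < lq \<and> j < lp then
         - (of_real (\<phi> k) * of_real (\<rho> j)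
            * ((?H (\<i> * of_real (\<omega> k)) - ?H (\<i> * of_real (\<zeta> j)))
               / (\<i> * of_real (\<omega> k) - \<i> * of_real (\<zeta> j))))
       else if k < lq then
         of_real (\<phi> k) * of_real \<rho>inf * ?H (\<i> * of_real (\<omega> k))
       else if j < lp then
         of_real \<phi>inf * of_real (\<rho> j) * ?H (\<i> * of_real (\<zeta> j))
       else
         of_real \<phi>inf * of_real \<rho>inf * of_real (markov0 E b c))"
    if k: "k < num_nodes lq inf_q" and j: "j < num_nodes lp inf_p" for k j
  proof -
    let ?X = "node_mat E A lq \<omega> k" and ?Y = "node_mat E A lp \<zeta> j"
    note X = node_mat_carrier[OF E A inv stable, of lq \<omega> k]
      and Y = node_mat_carrier[OF E A inv stable, of lp \<zeta> j]
    note entry = loewner_entry[OF E A b c inv stable k j, of \<omega> \<phi> \<phi>inf \<zeta> \<rho> \<rho>inf]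
    have Y_inf: "?X * cmat E * ?Y = ?X" if "\<not> j < lp"
      using that X assoc_mult_mat[OF X CE CI(1)] CI(2) by (simp add: node_mat_def)
    have X_inf: "?X * cmat E * ?Y = ?Y" if "\<not> k < lq"
    proof -
      have "?X * cmat E = 1\<^sub>m n" using that CI(3) by (simp add: node_mat_def)
      then show ?thesis using Y by simp
    qed
    consider (finite) "k < lq" "j < lp" | (col_inf) "k < lq" "\<not> j < lp"
      | (row_inf) "\<not> k < lq" "j < lp" | (both_inf) "\<not> k < lq" "\<not> j < lp" by blast
    then show ?thesis
    proof cases
      case finite
      have axis: "invertible_mat ((\<i> * of_real x) \<cdot>\<^sub>m cmat E - cmat A)" for x
        by (rule invertible_pencil[OF E A inv stable]) simp
      have "\<i> * complex_of_real (\<omega> k) \<noteq> \<i> * of_real (\<zeta> j)"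
        using nodes finite by simp
      from transfer_divided_difference[OF E A b c axis axis this] finite entry
      show ?thesis by (simp add: node_mat_def node_root_def)
    next
      case col_inf
      then show ?thesis
        unfolding entry Y_inf[OF col_inf(2)]
        by (simp add: node_mat_def node_root_def transfer_def)
    next
      case row_inf
      then show ?thesis
        unfolding entry X_inf[OF row_inf(1)]
        by (simp add: node_mat_def node_root_def transfer_def)
    next
      case both_inf
      then show ?thesis
        unfolding entry X_inf[OF both_inf(1)]
        by (simp add: node_mat_def node_root_def markov0_complex[OF E inv b c])
    qed
  qed
  show ?thesis
    unfolding Let_def using carrier entry by blast
qed

end
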